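(* For every $n\ge1$, $$(U^* )^nU^n=I,\qquad U^n(U^* )^n=I-P_n,\qquad [U^n,(U^* )^n]=-P_n,$$ where $P_n=\sum_{k=0}^{n-1}|e_k\rangle\langle e_k|$ is the orthogonal projection onto $\mathrm{span}\{e_0,\dots,e_{n-1}\}$. Consequently, for every $j\ge0$, $$\omega_j\bigl(U^n,(U^* )^n\bigr)=-\mathbf{1}_{\{j<n\}},\qquad\text{and}\qquad \sum_{j\ge0}\omega_j\bigl(U^n,(U^* )^n\bigr)=-n.$$
   Context: Let $(e_n)_{n\ge 0}$ be the canonical orthonormal basis of $\ell^2(\mathbb{Z}_{\ge 0})$ (inner product linear in the second argument). $U$ is the forward unilateral shift, $Ue_n=e_{n+1}$, with adjoint $U^*$. $|e_k\rangle\langle e_k|$ is the operator $f\mapsto\langle e_k,f\rangle e_k$. For bounded operators $X,Y$ and $j\ge0$, $\omega_j(X,Y)=\langle e_j,[X,Y]e_j\rangle$ with $[X,Y]=XY-YX$. $\mathbf{1}_{\{j<n\}}$ equals $1$ if $j<n$ and $0$ otherwise. *)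

theory Defs
  imports "HOL-Analysis.Analysis"
begin

section \<open>The Hilbert space of square-summable complex sequences\<close>

typedef ell2 = "{f :: nat \<Rightarrow> complex. summable (\<lambda>n. (cmod (f n))\<^sup>2)}"
  morphisms coord Abs_ell2
  by (rule exI[of _ "\<lambda>_. 0"]) simp

setup_lifting type_definition_ell2

lemma sq_summable_add:
  fixes f g :: "nat \<Rightarrow> complex"
  assumes "summable (\<lambda>n. (cmod (f n))\<^sup>2)" and "summable (\<lambda>n. (cmod (g n))\<^sup>2)"
  shows "summable (\<lambda>n. (cmod (f n + g n))\<^sup>2)"
proof (rule summable_comparison_test')
  show "summable (\<lambda>n. 2 * (cmod (f n))\<^sup>2 + 2 * (cmod (g n))\<^sup>2)"
    using assms by (intro summable_add summable_mult)
  fix n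
  have "(cmod (f n + g n))\<^sup>2 \<le> (cmod (f n) + cmod (g n))\<^sup>2"
    by (intro power_mono norm_triangle_ineq) auto
  also have "\<dots> \<le> 2 * (cmod (f n))\<^sup>2 + 2 * (cmod (g n))\<^sup>2"
    using sum_squares_bound[of "cmod (f n)" "cmod (g n)"]
    by (simp add: power2_sum)
  finally show "norm ((cmod (f n + g n))\<^sup>2) \<le> 2 * (cmod (f n))\<^sup>2 + 2 * (cmod (g n))\<^sup>2"
    by simp
qed

lemma sq_summable_scale:
  fixes f :: "nat \<Rightarrow> complex"
  assumes "summable (\<lambda>n. (cmod (f n))\<^sup>2)"
  shows "summable (\<lambda>n. (cmod (c * f n))\<^sup>2)"
  using summable_mult[OF assms, of "(cmod c)\<^sup>2"]
  by (simp add: norm_mult power_mult_distrib)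

lemma sq_summable_minus:
  fixes f g :: "nat \<Rightarrow> complex"
  assumes "summable (\<lambda>n. (cmod (f n))\<^sup>2)" and "summable (\<lambda>n. (cmod (g n))\<^sup>2)"
  shows "summable (\<lambda>n. (cmod (f n - g n))\<^sup>2)"
  using sq_summable_add[OF assms(1) sq_summable_scale[OF assms(2), of "-1"]] by simp

lemma summable_cnj_mult:
  fixes f g :: "nat \<Rightarrow> complex"
  assumes "summable (\<lambda>n. (cmod (f n))\<^sup>2)" and "summable (\<lambda>n. (cmod (g n))\<^sup>2)"
  shows "summable (\<lambda>n. cnj (f n) * g n)"
proof (rule summable_comparison_test')
  show "summable (\<lambda>n. (cmod (f n))\<^sup>2 + (cmod (g n))\<^sup>2)"
    using assms by (rule summable_add)
  fix n
  have "2 * (cmod (f n) * cmod (g n)) \<le> (cmod (f n))\<^sup>2 + (cmod (g n))\<^sup>2"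
    using sum_squares_bound[of "cmod (f n)" "cmod (g n)"] by simp
  moreover have "0 \<le> cmod (f n) * cmod (g n)" by simp
  ultimately show "norm (cnj (f n) * g n) \<le> (cmod (f n))\<^sup>2 + (cmod (g n))\<^sup>2"
    unfolding norm_mult complex_mod_cnj by linarith
qed

lift_definition scaleC :: "complex \<Rightarrow> ell2 \<Rightarrow> ell2" is "\<lambda>c f n. c * f n"
  by (rule sq_summable_scale)

lift_definition cinner :: "ell2 \<Rightarrow> ell2 \<Rightarrow> complex"
  is "\<lambda>f g. \<Sum>n. cnj (f n) * g n" .

text \<open>The norm is the one induced by \<open>cinner\<close>; the real inner product demanded by
  the class \<open>real_inner\<close> is the real part of \<open>cinner\<close>.\<close>

instantiation ell2 :: real_inner
begin

lift_definition zero_ell2 :: ell2 is "\<lambda>_. 0" by simp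

lift_definition plus_ell2 :: "ell2 \<Rightarrow> ell2 \<Rightarrow> ell2" is "\<lambda>f g n. f n + g n"
  by (rule sq_summable_add)

lift_definition minus_ell2 :: "ell2 \<Rightarrow> ell2 \<Rightarrow> ell2" is "\<lambda>f g n. f n - g n"
  by (rule sq_summable_minus)

lift_definition uminus_ell2 :: "ell2 \<Rightarrow> ell2" is "\<lambda>f n. - f n"
  by simp

definition scaleR_ell2 :: "real \<Rightarrow> ell2 \<Rightarrow> ell2"
  where "scaleR_ell2 r f = scaleC (complex_of_real r) f"

definition inner_ell2 :: "ell2 \<Rightarrow> ell2 \<Rightarrow> real"
  where "inner_ell2 f g = Re (cinner f g)"

definition norm_ell2 :: "ell2 \<Rightarrow> real"
  where "norm_ell2 f = sqrt (Re (cinner f f))"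

definition sgn_ell2 :: "ell2 \<Rightarrow> ell2"
  where "sgn_ell2 f = inverse (norm f) *\<^sub>R f"

definition dist_ell2 :: "ell2 \<Rightarrow> ell2 \<Rightarrow> real"
  where "dist_ell2 f g = norm (f - g)"

definition uniformity_ell2 :: "(ell2 \<times> ell2) filter"
  where "uniformity_ell2 = (INF e\<in>{0 <..}. principal {(x, y). dist x y < e})"

definition open_ell2 :: "ell2 set \<Rightarrow> bool"
  where "open_ell2 S = (\<forall>x\<in>S. \<forall>\<^sub>F (x', y) in uniformity. x' = x \<longrightarrow> y \<in> S)"

instance
proof
  fix x y z :: ell2 and r s :: real
  show "x + y + z = x + (y + z)" by transfer (simp add: algebra_simps)
  show "x + y = y + x" by transfer (simp add: algebra_simps)
  show "0 + x = x" by transfer simp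
  show "- x + x = 0" by transfer simp
  show "x - y = x + - y" by transfer simp
  show "r *\<^sub>R (x + y) = r *\<^sub>R x + r *\<^sub>R y"
    unfolding scaleR_ell2_def by transfer (simp add: algebra_simps)
  show "(r + s) *\<^sub>R x = r *\<^sub>R x + s *\<^sub>R x"
    unfolding scaleR_ell2_def by transfer (simp add: algebra_simps)
  show "r *\<^sub>R s *\<^sub>R x = (r * s) *\<^sub>R x"
    unfolding scaleR_ell2_def by transfer (simp add: algebra_simps)
  show "1 *\<^sub>R x = x"
    unfolding scaleR_ell2_def by transfer simp
  show "sgn x = inverse (norm x) *\<^sub>R x" by (rule sgn_ell2_def)
  show "dist x y = norm (x - y)" by (rule dist_ell2_def)
  show "(uniformity :: (ell2 \<times> ell2) filter) = (INF e\<in>{0 <..}. principal {(x, y). dist x y < e})"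
    by (rule uniformity_ell2_def)
  show "open U = (\<forall>x\<in>U. \<forall>\<^sub>F (x', y) in uniformity. x' = x \<longrightarrow> y \<in> U)" for U :: "ell2 set"
    by (rule open_ell2_def)
  show "inner x y = inner y x"
    unfolding inner_ell2_def
  proof transfer
    fix f g :: "nat \<Rightarrow> complex"
    assume f: "summable (\<lambda>n. (cmod (f n))\<^sup>2)" and g: "summable (\<lambda>n. (cmod (g n))\<^sup>2)"
    have "Re (\<Sum>n. cnj (f n) * g n) = (\<Sum>n. Re (cnj (f n) * g n))"
      by (rule Re_suminf[OF summable_cnj_mult[OF f g]])
    also have "\<dots> = (\<Sum>n. Re (cnj (g n) * f n))"
      by (simp add: mult.commute)
    also have "\<dots> = Re (\<Sum>n. cnj (g n) * f n)"
      by (rule Re_suminf[OF summable_cnj_mult[OF g f], symmetric])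
    finally show "Re (\<Sum>n. cnj (f n) * g n) = Re (\<Sum>n. cnj (g n) * f n)" .
  qed
  show "inner (x + y) z = inner x z + inner y z"
    unfolding inner_ell2_def
    by transfer (simp add: ring_distribs suminf_add[symmetric] summable_cnj_mult)
  show "inner (r *\<^sub>R x) y = r * inner x y"
    unfolding inner_ell2_def scaleR_ell2_def
    by transfer (simp add: mult.assoc suminf_mult summable_cnj_mult)
  have sq: "cnj c * c = complex_of_real ((cmod c)\<^sup>2)" for c
    by (simp only: mult.commute[of "cnj _"] complex_norm_square)
  have self: "inner x x = (\<Sum>n. (cmod (coord x n))\<^sup>2)"
    unfolding inner_ell2_def
  proof transfer
    fix f :: "nat \<Rightarrow> complex"
    assume f: "summable (\<lambda>n. (cmod (f n))\<^sup>2)"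
    have "Re (\<Sum>n. cnj (f n) * f n) = (\<Sum>n. Re (cnj (f n) * f n))"
      by (rule Re_suminf[OF summable_cnj_mult[OF f f]])
    then show "Re (\<Sum>n. cnj (f n) * f n) = (\<Sum>n. (cmod (f n))\<^sup>2)"
      unfolding sq by simp
  qed
  have sm: "summable (\<lambda>n. (cmod (coord x n))\<^sup>2)"
    using coord[of x] by simp
  show "0 \<le> inner x x"
    unfolding self by (rule suminf_nonneg[OF sm]) simp
  have "inner x x = 0 \<longleftrightarrow> (\<forall>n. coord x n = 0)"
    unfolding self using suminf_eq_zero_iff[OF sm] by simp
  then show "inner x x = 0 \<longleftrightarrow> x = 0"
    by (simp add: coord_inject[symmetric] zero_ell2.rep_eq fun_eq_iff)
  show "norm x = sqrt (inner x x)"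
    by (simp add: norm_ell2_def inner_ell2_def)
qed

end

interpretation ell2: vector_space scaleC
  by standard (transfer, simp add: algebra_simps)+

lift_definition basis_vec :: "nat \<Rightarrow> ell2" is "\<lambda>k n. if n = k then 1 else 0"
  by (rule summable_finite[of "{k}" for k]) auto

lemma cinner_add_right: "cinner f (g + h) = cinner f g + cinner f h"
  by transfer (simp add: ring_distribs suminf_add[symmetric] summable_cnj_mult)

lemma cinner_scaleC_right: "cinner f (scaleC c g) = c * cinner f g"
  by transfer (simp add: mult.left_commute suminf_mult summable_cnj_mult)

lemma norm_scaleC: "norm (scaleC c f) = cmod c * norm f"
proof -
  have "cinner (scaleC c f) (scaleC c f) = (cnj c * c) * cinner f f"
  proof transfer
    fix c :: complex and f :: "nat \<Rightarrow> complex"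
    assume f: "summable (\<lambda>n. (cmod (f n))\<^sup>2)"
    show "(\<Sum>n. cnj (c * f n) * (c * f n)) = cnj c * c * (\<Sum>n. cnj (f n) * f n)"
      using suminf_mult[OF summable_cnj_mult[OF f f], of "cnj c * c"]
      by (simp add: mult.assoc mult.left_commute)
  qed
  also have "cnj c * c = complex_of_real ((cmod c)\<^sup>2)"
    by (simp only: mult.commute[of "cnj _"] complex_norm_square)
  finally show ?thesis
    by (simp add: norm_ell2_def real_sqrt_mult)
qed

lemma cmod_cinner_le: "cmod (cinner f g) \<le> norm f * norm g"
proof (cases "cinner f g = 0")
  case False
  define c where "c = cnj (cinner f g) / cmod (cinner f g)"
  have c: "cmod c = 1" using False by (simp add: c_def norm_divide)
  have "cnj (cinner f g) * cinner f g = complex_of_real ((cmod (cinner f g))\<^sup>2)"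
    by (simp only: mult.commute[of "cnj _"] complex_norm_square)
  then have "c * cinner f g = cmod (cinner f g)"
    using False by (simp add: c_def power2_eq_square)
  then have "cmod (cinner f g) = inner f (scaleC c g)"
    by (simp add: inner_ell2_def cinner_scaleC_right)
  also have "\<dots> \<le> norm f * norm (scaleC c g)"
    by (rule norm_cauchy_schwarz)
  finally show ?thesis by (simp add: norm_scaleC c)
qed simp


section \<open>Bounded operators\<close>

text \<open>\<open>bounded_linear\<close> only asks for real linearity, hence the additional
  clause.\<close>

typedef ell2_op =
  "{T :: ell2 \<Rightarrow> ell2. bounded_linear T \<and> (\<forall>c f. T (scaleC c f) = scaleC c (T f))}"
  morphisms op_apply Abs_ell2_op
  by (rule exI[of _ "\<lambda>_. 0"]) simp

setup_lifting type_definition_ell2_op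

lemma ell2_op_eqI: "(\<And>f. op_apply S f = op_apply T f) \<Longrightarrow> S = T"
  by (simp add: op_apply_inject[symmetric] fun_eq_iff)

text \<open>The product is composition, so powers \<open>T ^ n\<close> are iterates and \<open>1\<close> is the
  identity operator.\<close>

instantiation ell2_op :: ring_1
begin

lift_definition zero_ell2_op :: ell2_op is "\<lambda>_. 0" by simp

lift_definition one_ell2_op :: ell2_op is "\<lambda>f. f" by simp

lift_definition plus_ell2_op :: "ell2_op \<Rightarrow> ell2_op \<Rightarrow> ell2_op" is "\<lambda>S T f. S f + T f"
  by (simp add: bounded_linear_add ell2.scale_right_distrib)

lift_definition minus_ell2_op :: "ell2_op \<Rightarrow> ell2_op \<Rightarrow> ell2_op" is "\<lambda>S T f. S f - T f"
  by (simp add: bounded_linear_sub ell2.scale_right_diff_distrib)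

lift_definition uminus_ell2_op :: "ell2_op \<Rightarrow> ell2_op" is "\<lambda>T f. - T f"
  by (simp add: bounded_linear_minus)

lift_definition times_ell2_op :: "ell2_op \<Rightarrow> ell2_op \<Rightarrow> ell2_op" is "\<lambda>S T f. S (T f)"
  by (simp add: bounded_linear_compose)

instance
proof
  fix a b c :: ell2_op
  show "a * b * c = a * (b * c)" by transfer simp
  show "1 * a = a" by transfer simp
  show "a * 1 = a" by transfer simp
  show "a + b + c = a + (b + c)" by transfer (simp add: algebra_simps)
  show "a + b = b + a" by transfer (simp add: algebra_simps)
  show "0 + a = a" by transfer simp
  show "- a + a = 0" by transfer simp
  show "a - b = a + - b" by transfer simp
  show "(a + b) * c = a * c + b * c" by transfer simp
  show "a * (b + c) = a * b + a * c"
    by transfer (simp add: linear_add bounded_linear.linear)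
  have "coord (basis_vec 0) 0 \<noteq> coord 0 0"
    by (simp add: basis_vec.rep_eq zero_ell2.rep_eq)
  then have "op_apply 0 (basis_vec 0) \<noteq> op_apply 1 (basis_vec 0)"
    by (auto simp: zero_ell2_op.rep_eq one_ell2_op.rep_eq)
  then show "(0::ell2_op) \<noteq> 1" by auto
qed

end

text \<open>The adjoint exists by the Riesz representation theorem, and it is unique because
  \<open>cinner\<close> is definite.\<close>

definition adj :: "ell2_op \<Rightarrow> ell2_op"
  where "adj T = (THE S. \<forall>f g. cinner f (op_apply T g) = cinner (op_apply S f) g)"

definition commutator :: "ell2_op \<Rightarrow> ell2_op \<Rightarrow> ell2_op"
  where "commutator X Y = X * Y - Y * X"

text \<open>The operator written \<open>|u\<rangle>\<langle>v|\<close> in Dirac notation.\<close>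

lift_definition ketbra :: "ell2 \<Rightarrow> ell2 \<Rightarrow> ell2_op" is "\<lambda>u v f. scaleC (cinner v f) u"
proof (intro conjI allI)
  fix u v f :: ell2 and c :: complex
  show "bounded_linear (\<lambda>f. scaleC (cinner v f) u)"
  proof (rule bounded_linear_intro)
    fix f g :: ell2 and r :: real
    show "scaleC (cinner v (f + g)) u = scaleC (cinner v f) u + scaleC (cinner v g) u"
      by (simp add: cinner_add_right ell2.scale_left_distrib)
    show "scaleC (cinner v (r *\<^sub>R f)) u = r *\<^sub>R scaleC (cinner v f) u"
      by (simp add: scaleR_ell2_def cinner_scaleC_right)
    show "norm (scaleC (cinner v f) u) \<le> norm f * (norm v * norm u)"
      using mult_right_mono[OF cmod_cinner_le[of v f] norm_ge_zero[of u]]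
      by (simp add: norm_scaleC mult_ac)
  qed
  show "scaleC (cinner v (scaleC c f)) u = scaleC c (scaleC (cinner v f) u)"
    by (simp add: cinner_scaleC_right)
qed

definition is_orthogonal_projection :: "ell2_op \<Rightarrow> ell2 set \<Rightarrow> bool"
  where "is_orthogonal_projection P M \<longleftrightarrow>
    (\<forall>f. op_apply P f \<in> M \<and> (\<forall>g\<in>M. cinner g (f - op_apply P f) = 0))"

lift_definition shift_vec :: "ell2 \<Rightarrow> ell2"
  is "\<lambda>f n. case n of 0 \<Rightarrow> 0 | Suc m \<Rightarrow> f m"
  by (subst summable_Suc_iff[symmetric]) simp

lemma norm_shift_vec: "norm (shift_vec f) = norm f"
proof -
  have "cinner (shift_vec f) (shift_vec f) = cinner f f"
  proof transfer
    fix f :: "nat \<Rightarrow> complex"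
    let ?h = "\<lambda>n. case n of 0 \<Rightarrow> 0 | Suc m \<Rightarrow> f m"
    assume f: "summable (\<lambda>n. (cmod (f n))\<^sup>2)"
    have "summable (\<lambda>n. cnj (?h n) * ?h n)"
      by (subst summable_Suc_iff[symmetric]) (simp add: summable_cnj_mult[OF f f])
    from suminf_split_head[OF this]
    show "(\<Sum>n. cnj (?h n) * ?h n) = (\<Sum>n. cnj (f n) * f n)" by simp
  qed
  then show ?thesis by (simp add: norm_ell2_def)
qed

lift_definition shift :: ell2_op is shift_vec
proof (intro conjI allI)
  have add: "shift_vec (f + g) = shift_vec f + shift_vec g" for f g
    by transfer (auto simp: fun_eq_iff split: nat.split)
  have scale: "shift_vec (scaleC c f) = scaleC c (shift_vec f)" for c f
    by transfer (auto simp: fun_eq_iff split: nat.split)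
  show "shift_vec (scaleC c f) = scaleC c (shift_vec f)" for c f
    by (rule scale)
  show "bounded_linear shift_vec"
    by (rule bounded_linear_intro[where K = 1])
      (simp_all add: add scale scaleR_ell2_def norm_shift_vec)
qed

lemma shift_basis_vec: "op_apply shift (basis_vec n) = basis_vec (Suc n)"
  unfolding shift.rep_eq by transfer (auto simp: fun_eq_iff split: nat.split)

definition proj_first :: "nat \<Rightarrow> ell2_op"
  where "proj_first n = (\<Sum>k<n. ketbra (basis_vec k) (basis_vec k))"

definition omega :: "nat \<Rightarrow> ell2_op \<Rightarrow> ell2_op \<Rightarrow> complex"
  where "omega j X Y = cinner (basis_vec j) (op_apply (commutator X Y) (basis_vec j))"

end

theory Submission
  imports Defs
begin

text \<open>The adjoint of the shift is the operator that drops the zeroth coordinate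
  (\<open>adj_shift\<close>), so everything can be read off in coordinates. \<open>shift ^ n\<close>
  moves coordinates up by n and fills with zeros; \<open>backshift ^ n\<close> moves them down by n
  and loses the first n. Up then down restores every vector, while down then up erases exactly the
  coordinates below n, which gives \<open>1 - proj_first n\<close>. The commutator is the difference
  of these two products, and \<open>omega j\<close> is its j-th diagonal entry, nonzero for just n
  indices.\<close>

lemma ell2_eqI: "(\<And>k. coord f k = coord g k) \<Longrightarrow> f = g"
  by (simp add: coord_inject[symmetric] fun_eq_iff)

lemma cinner_eq_suminf: "cinner f g = (\<Sum>k. cnj (coord f k) * coord g k)"
  by transfer simp

lemma cinner_basis_vec_left: "cinner (basis_vec k) f = coord f k"
proof -
  have "(\<lambda>m. cnj (coord (basis_vec k) m) * coord f m) = (\<lambda>m. if m = k then coord f m else 0)"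
    by (auto simp: basis_vec.rep_eq)
  then show ?thesis
    unfolding cinner_eq_suminf using sums_single[of k "coord f"] by (simp add: sums_iff)
qed

lemma cinner_basis_vec_right: "cinner f (basis_vec k) = cnj (coord f k)"
proof -
  have "(\<lambda>m. cnj (coord f m) * coord (basis_vec k) m) = (\<lambda>m. if m = k then cnj (coord f m) else 0)"
    by (auto simp: basis_vec.rep_eq)
  then show ?thesis
    unfolding cinner_eq_suminf using sums_single[of k "\<lambda>m. cnj (coord f m)"] by (simp add: sums_iff)
qed

lemma coord_shift:
  "coord (op_apply shift f) k = (case k of 0 \<Rightarrow> 0 | Suc m \<Rightarrow> coord f m)"
  by (simp add: shift.rep_eq shift_vec.rep_eq)

text \<open>Since \<open>adj\<close> is a definite description, its value has to be exhibited; this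
  is the candidate.\<close>

lift_definition backshift_vec :: "ell2 \<Rightarrow> ell2" is "\<lambda>f n. f (Suc n)"
  by (subst summable_Suc_iff) simp

text \<open>Only the zeroth coordinate is lost. Stated for vectors, it is available before the
  backshift is known to be bounded and serves to prove that.\<close>

lemma shift_vec_backshift_vec:
  "shift_vec (backshift_vec f) = f - op_apply (ketbra (basis_vec 0) (basis_vec 0)) f"
  by (rule ell2_eqI)
    (simp add: shift_vec.rep_eq backshift_vec.rep_eq ketbra.rep_eq minus_ell2.rep_eq
      scaleC.rep_eq basis_vec.rep_eq cinner_basis_vec_left split: nat.split)

lift_definition backshift :: ell2_op is backshift_vec
proof (intro conjI allI)
  have add: "backshift_vec (f + g) = backshift_vec f + backshift_vec g" for f g
    by transfer simp
  have scale: "backshift_vec (scaleC c f) = scaleC c (backshift_vec f)" for c f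
    by transfer simp
  show "backshift_vec (scaleC c f) = scaleC c (backshift_vec f)" for c f
    by (rule scale)
  \<comment> \<open>The shift is isometric, so the norm of the backshift is that of a bounded operator.\<close>
  have "bounded_linear (\<lambda>f. f - op_apply (ketbra (basis_vec 0) (basis_vec 0)) f)"
    using op_apply by (intro bounded_linear_sub bounded_linear_ident) auto
  then obtain K where
    "\<And>f. norm (f - op_apply (ketbra (basis_vec 0) (basis_vec 0)) f) \<le> norm f * K"
    using bounded_linear.bounded by blast
  then have "norm (backshift_vec f) \<le> norm f * K" for f
    by (metis norm_shift_vec shift_vec_backshift_vec)
  then show "bounded_linear backshift_vec"
    by (intro bounded_linear_intro[where K = K]) (simp_all add: add scale scaleR_ell2_def)
qed

lemma coord_backshift: "coord (op_apply backshift f) k = coord f (Suc k)"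
  by (simp add: backshift.rep_eq backshift_vec.rep_eq)

text \<open>The shifted vector is zero at index 0, so splitting off the head of the series reindexes
  it.\<close>

lemma cinner_shift_right: "cinner f (op_apply shift g) = cinner (op_apply backshift f) g"
proof -
  have "summable (\<lambda>k. cnj (coord f k) * coord (op_apply shift g) k)"
    using coord by (intro summable_cnj_mult) auto
  from suminf_split_head[OF this] show ?thesis
    by (simp add: cinner_eq_suminf coord_shift coord_backshift)
qed

lemma adj_shift: "adj shift = backshift"
  unfolding adj_def
proof (rule the_equality)
  show "\<forall>f g. cinner f (op_apply shift g) = cinner (op_apply backshift f) g"
    by (simp add: cinner_shift_right)
next
  fix S
  assume "\<forall>f g. cinner f (op_apply shift g) = cinner (op_apply S f) g"
  \<comment> \<open>Uniqueness: pairing with basis vectors recovers all coordinates of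
    \<open>op_apply S f\<close>, up to conjugation.\<close>
  then have "cinner (op_apply S f) (basis_vec k) = cinner (op_apply backshift f) (basis_vec k)" for f k
    by (simp add: cinner_shift_right)
  then show "S = backshift"
    by (intro ell2_op_eqI ell2_eqI) (simp add: cinner_basis_vec_right)
qed

text \<open>The index is generalized because peeling off one factor lowers it by one. The truncated
  \<open>k - n\<close> is reached only when n \<le> k.\<close>

lemma coord_shift_power:
  "coord (op_apply (shift ^ n) f) k = (if k < n then 0 else coord f (k - n))"
  by (induction n arbitrary: k)
    (auto simp: one_ell2_op.rep_eq times_ell2_op.rep_eq coord_shift split: nat.split)

lemma coord_backshift_power: "coord (op_apply (backshift ^ n) f) k = coord f (k + n)"
  by (induction n arbitrary: k)
    (auto simp: one_ell2_op.rep_eq times_ell2_op.rep_eq coord_backshift)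

lemma op_apply_proj_first:
  "op_apply (proj_first n) f = (\<Sum>k<n. scaleC (coord f k) (basis_vec k))"
  unfolding proj_first_def
  by (induction n)
    (simp_all add: zero_ell2_op.rep_eq plus_ell2_op.rep_eq ketbra.rep_eq cinner_basis_vec_left)

lemma coord_proj_first:
  "coord (op_apply (proj_first n) f) k = (if k < n then coord f k else 0)"
  unfolding op_apply_proj_first
  by (induction n)
    (auto simp: zero_ell2.rep_eq plus_ell2.rep_eq scaleC.rep_eq basis_vec.rep_eq less_Suc_eq)

lemma backshift_power_mult_shift_power: "backshift ^ n * shift ^ n = 1"
  by (intro ell2_op_eqI ell2_eqI)
    (simp add: times_ell2_op.rep_eq one_ell2_op.rep_eq coord_backshift_power coord_shift_power)

lemma shift_power_mult_backshift_power: "shift ^ n * backshift ^ n = 1 - proj_first n"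
  by (intro ell2_op_eqI ell2_eqI)
    (simp add: times_ell2_op.rep_eq one_ell2_op.rep_eq minus_ell2_op.rep_eq minus_ell2.rep_eq
      coord_backshift_power coord_shift_power coord_proj_first)

lemma commutator_shift_power: "commutator (shift ^ n) (adj shift ^ n) = - proj_first n"
  by (simp add: commutator_def adj_shift backshift_power_mult_shift_power
      shift_power_mult_backshift_power)

text \<open>The generators vanish from index n on, and linear combinations preserve this.\<close>

lemma coord_eq_0_of_span:
  assumes "g \<in> ell2.span (basis_vec ` {..<n})" "n \<le> k"
  shows "coord g k = 0"
  using assms(1)
  by (induction rule: ell2.span_induct_alt)
    (use assms(2) in \<open>auto simp: zero_ell2.rep_eq plus_ell2.rep_eq scaleC.rep_eq basis_vec.rep_eq\<close>)

lemma is_orthogonal_projection_proj_first: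
  "is_orthogonal_projection (proj_first n) (ell2.span (basis_vec ` {..<n}))"
  unfolding is_orthogonal_projection_def
proof (intro allI conjI ballI)
  fix f g
  show "op_apply (proj_first n) f \<in> ell2.span (basis_vec ` {..<n})"
    unfolding op_apply_proj_first
    by (intro ell2.span_sum ell2.span_scale ell2.span_base) auto
  assume g: "g \<in> ell2.span (basis_vec ` {..<n})"
  \<comment> \<open>Disjoint supports: \<open>g\<close> lives below n, the residual from n on, so
    the inner product vanishes term by term.\<close>
  have "cnj (coord g k) * coord (f - op_apply (proj_first n) f) k = 0" for k
    using coord_eq_0_of_span[OF g, of k] by (simp add: minus_ell2.rep_eq coord_proj_first)
  then show "cinner g (f - op_apply (proj_first n) f) = 0"
    by (simp only: cinner_eq_suminf suminf_zero)
qed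

lemma omega_shift_power:
  "omega j (shift ^ n) (adj shift ^ n) = - (if j < n then 1 else 0)"
  by (simp add: omega_def commutator_shift_power cinner_basis_vec_left uminus_ell2_op.rep_eq
      uminus_ell2.rep_eq coord_proj_first basis_vec.rep_eq)

text \<open>The series has finite support and adds -1 over n indices. A commutator of matrices has
  trace zero, so a nonzero value is an infinite-dimensional effect.\<close>

lemma omega_shift_power_sums:
  "(\<lambda>j. omega j (shift ^ n) (adj shift ^ n)) sums (- of_nat n)"
  unfolding omega_shift_power
  using sums_minus[OF sums_If_finite_set[of "{..<n}" "\<lambda>_. 1 :: complex"]] by simp

theorem lemma4p1:
  fixes n :: nat
  assumes "n \<ge> 1"
  shows "adj shift ^ n * shift ^ n = 1
    \<and> shift ^ n * adj shift ^ n = 1 - proj_first n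
    \<and> commutator (shift ^ n) (adj shift ^ n) = - proj_first n
    \<and> is_orthogonal_projection (proj_first n) (ell2.span (basis_vec ` {..<n}))
    \<and> (\<forall>j. omega j (shift ^ n) (adj shift ^ n) = - (if j < n then 1 else 0))
    \<and> (\<lambda>j. omega j (shift ^ n) (adj shift ^ n)) sums (- of_nat n)"
  using backshift_power_mult_shift_power shift_power_mult_backshift_power commutator_shift_power
    is_orthogonal_projection_proj_first omega_shift_power omega_shift_power_sums
  by (simp only: adj_shift simp_thms)

end
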